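(* Let $S$ be a finite semigroup. Then $\mathbf{C}(S)$ is finite if and only if $S$ is $\mathcal{H}$-trivial (i.e. every class of Green's relation $\mathcal{H}$ on $S$ is a singleton).
   Context: Cayley automaton semigroup: for a finite (non-empty) semigroup $S$, the Cayley automaton $\mathcal{C}(S)$ has state set $S$ and alphabet $S$; when in state $s$ (written $\overline{s}$ to distinguish states from symbols) and reading a symbol $t$, it outputs $st$ and moves to state $\overline{st}$. Thus each state defines a transformation $\overline{s}$ of the set $S^{\infty}$ of infinite sequences over $S$, given by $(x_1,x_2,x_3,\ldots)\cdot\overline{s}=(sx_1,\,sx_1x_2,\,sx_1x_2x_3,\ldots)$. Transformations act on the right and are composed left to right: $\alpha\cdot(\overline{s}\cdot\overline{t})=(\alpha\cdot\overline{s})\cdot\overline{t}$. $\mathbf{C}(S)$ is the semigroup of transformations of $S^{\infty}$ generated by $\{\overline{s}:s\in S\}$. *)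

theory Defs
  imports Main
begin

text \<open>
  A finite non-empty semigroup is a type of class semigroup_mult and finite. An infinite
  sequence $(x_1, x_2, \ldots)$ is a function on nat, with $x_{n+1}$ the value at $n$.
\<close>

type_synonym 'a transformation = "(nat \<Rightarrow> 'a) \<Rightarrow> (nat \<Rightarrow> 'a)"

subsection \<open>Synchronous automata and their action on infinite sequences\<close>

text \<open>An automaton maps a state and an input symbol to the pair (new state, output symbol).\<close>

type_synonym ('q, 'a) automaton = "'q \<Rightarrow> 'a \<Rightarrow> 'q \<times> 'a"

primrec run :: "('q, 'a) automaton \<Rightarrow> 'q \<Rightarrow> (nat \<Rightarrow> 'a) \<Rightarrow> nat \<Rightarrow> 'q" where
  "run A q x 0 = q"
| "run A q x (Suc n) = fst (A (run A q x n) (x n))"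

definition state_action :: "('q, 'a) automaton \<Rightarrow> 'q \<Rightarrow> 'a transformation" where
  "state_action A q x n = snd (A (run A q x n) (x n))"

text \<open>Transformations act on the right, so the product of f and g is "first f, then g".\<close>

inductive_set generated_semigroup :: "'a transformation set \<Rightarrow> 'a transformation set"
  for T :: "'a transformation set" where
  generator: "f \<in> T \<Longrightarrow> f \<in> generated_semigroup T"
| product: "f \<in> generated_semigroup T \<Longrightarrow> g \<in> generated_semigroup T \<Longrightarrow>
    g \<circ> f \<in> generated_semigroup T"

subsection \<open>Cayley automaton semigroups\<close>

definition cayley_automaton :: "('a::semigroup_mult, 'a) automaton" where
  "cayley_automaton s t = (s * t, s * t)"

definition cayley_semigroup :: "'a::semigroup_mult transformation set" where
  "cayley_semigroup = generated_semigroup (range (state_action cayley_automaton))"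

lemma cayley_action_0: "state_action cayley_automaton s x 0 = s * x 0"
  by (simp add: state_action_def cayley_automaton_def)

lemma cayley_action_Suc:
  "state_action cayley_automaton s x (Suc n) = state_action cayley_automaton s x n * x (Suc n)"
  by (simp add: state_action_def cayley_automaton_def)

subsection \<open>Green's relations\<close>

text \<open>The principal one-sided ideals $S^1 a$ and $a S^1$.\<close>

definition left_ideal :: "'a::semigroup_mult \<Rightarrow> 'a set" where
  "left_ideal a = insert a {s * a | s. True}"

definition right_ideal :: "'a::semigroup_mult \<Rightarrow> 'a set" where
  "right_ideal a = insert a {a * s | s. True}"

definition green_L :: "'a::semigroup_mult rel" where
  "green_L = {(a, b). left_ideal a = left_ideal b}"

definition green_R :: "'a::semigroup_mult rel" where
  "green_R = {(a, b). right_ideal a = right_ideal b}"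

definition green_H :: "'a::semigroup_mult rel" where
  "green_H = green_L \<inter> green_R"

lemma equiv_green_H: "equiv UNIV green_H"
  by (auto simp: green_H_def green_L_def green_R_def equiv_def refl_on_def sym_def trans_def)

end

theory Submission
  imports Defs
begin

text \<open>
  If \<open>S\<close> is not \<open>\<H>\<close>-trivial, it contains a nontrivial cyclic group with generator \<open>g\<close> and
  identity \<open>e\<close>. The state \<open>e\<close> forms partial products, that is, it divides by \<open>1 - t\<close> if sequences
  over the group are read as power series, so it undoes one factor of \<open>(1 - t)\<^sup>j\<close> applied to
  \<open>(g, e, e, \<dots>)\<close>. Hence its powers are distinct.

  Conversely, a product of states is a word \<open>c\<^sub>1 \<dots> c\<^sub>k\<close>, which turns into the word with letters
  \<open>c\<^sub>j \<dots> c\<^sub>1 y\<close> when it reads \<open>y\<close>. These letters descend in the \<open>\<L>\<close>-order. By induction along a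
  chain of ideals, here given by bounds on \<open>rank\<close>, one may ignore the letters that have fallen into
  a smaller ideal; what remains is a word inside one \<open>\<L>\<close>-class. In an \<open>\<H>\<close>-trivial semigroup such a
  word \<open>a\<^sub>1 \<dots> a\<^sub>k\<close> reads \<open>y\<close> by passing to a prefix of \<open>a\<^sub>1y \<dots> a\<^sub>ky\<close> that ends with the first letter
  in some set, followed by letters in the smaller ideal. Hence the number of its states is bounded
  independently of \<open>k\<close>.
\<close>

section \<open>Green's relations\<close>

lemma left_ideal_mult_subset: "left_ideal (a * b) \<subseteq> left_ideal (b :: 'a::semigroup_mult)"
  by (auto simp: left_ideal_def mult.assoc) (metis mult.assoc)

lemma right_ideal_mult_subset: "right_ideal (a * b) \<subseteq> right_ideal (a :: 'a::semigroup_mult)"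
  by (auto simp: right_ideal_def mult.assoc)

lemma left_ideal_mult: "left_ideal (a * b) = (\<lambda>s. s * b) ` left_ideal (a :: 'a::semigroup_mult)"
  by (force simp: left_ideal_def mult.assoc)

lemma right_ideal_mult: "right_ideal (a * b) = (\<lambda>s. a * s) ` right_ideal (b :: 'a::semigroup_mult)"
  by (force simp: right_ideal_def mult.assoc)

lemma green_L_cases:
  assumes "(a, b) \<in> green_L"
  obtains "a = b" | u where "a = u * b"
proof -
  have "a \<in> left_ideal b" using assms by (auto simp: green_L_def left_ideal_def)
  then show ?thesis using that by (auto simp: left_ideal_def)
qed

lemma green_R_cases:
  assumes "(a, b) \<in> green_R"
  obtains "a = b" | u where "a = b * u"
proof -
  have "a \<in> right_ideal b" using assms by (auto simp: green_R_def right_ideal_def)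
  then show ?thesis using that by (auto simp: right_ideal_def)
qed

lemma green_L_sym: "(a, b) \<in> green_L \<Longrightarrow> (b, a) \<in> green_L"
  by (simp add: green_L_def)

lemma green_L_trans: "(a, b) \<in> green_L \<Longrightarrow> (b, c) \<in> green_L \<Longrightarrow> (a, c) \<in> green_L"
  by (simp add: green_L_def)

lemma green_L_mult: "(a, b) \<in> green_L \<Longrightarrow> (a * y, b * y) \<in> green_L"
  by (simp add: green_L_def left_ideal_mult)

lemma singleton_green_H_classes_iff:
  "(\<forall>K \<in> UNIV // (green_H :: 'a::semigroup_mult rel). is_singleton K) \<longleftrightarrow>
    (\<forall>a b :: 'a. (a, b) \<in> green_H \<longrightarrow> a = b)"
proof -
  have refl: "(a, a) \<in> green_H" for a :: 'a
    by (auto simp: green_H_def green_L_def green_R_def)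
  have "is_singleton (green_H `` {a}) \<longleftrightarrow> (\<forall>b. (a, b) \<in> green_H \<longrightarrow> a = b)" for a :: 'a
    using refl[of a] by (auto simp: is_singleton_def dest: equalityD1)
  then show ?thesis
    by (auto simp: quotient_def)
qed

text \<open>A height for the J-order. Multiplication on either side increases neither summand, so
  equal rank forces both to agree; this is how stability of finite semigroups enters.\<close>

definition rank :: "'a::{semigroup_mult, finite} \<Rightarrow> nat" where
  "rank a = card (left_ideal a) + card (right_ideal a)"

lemma card_ideal_mult_le:
  fixes a b :: "'a::{semigroup_mult, finite}"
  shows "card (left_ideal (a * b)) \<le> card (left_ideal a)"
    and "card (left_ideal (a * b)) \<le> card (left_ideal b)"
    and "card (right_ideal (a * b)) \<le> card (right_ideal a)"
    and "card (right_ideal (a * b)) \<le> card (right_ideal b)"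
proof -
  show "card (left_ideal (a * b)) \<le> card (left_ideal a)"
    unfolding left_ideal_mult by (rule card_image_le) simp
  show "card (left_ideal (a * b)) \<le> card (left_ideal b)"
    by (rule card_mono[OF finite left_ideal_mult_subset])
  show "card (right_ideal (a * b)) \<le> card (right_ideal a)"
    by (rule card_mono[OF finite right_ideal_mult_subset])
  show "card (right_ideal (a * b)) \<le> card (right_ideal b)"
    unfolding right_ideal_mult by (rule card_image_le) simp
qed

lemma rank_mult_le:
  fixes a b :: "'a::{semigroup_mult, finite}"
  shows "rank (a * b) \<le> rank a" and "rank (a * b) \<le> rank b"
  using card_ideal_mult_le[of a b] by (simp_all add: rank_def add_mono)

lemma green_R_if_rank_eq:
  fixes a b :: "'a::{semigroup_mult, finite}"
  assumes "rank (a * b) = rank a"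
  shows "(a * b, a) \<in> green_R"
proof -
  have "card (right_ideal (a * b)) = card (right_ideal a)"
    using assms card_ideal_mult_le[of a b] by (simp add: rank_def)
  then show ?thesis
    by (simp add: green_R_def card_subset_eq right_ideal_mult_subset)
qed

lemma green_L_if_rank_eq:
  fixes a b :: "'a::{semigroup_mult, finite}"
  assumes "rank (a * b) = rank b"
  shows "(a * b, b) \<in> green_L"
proof -
  have "card (left_ideal (a * b)) = card (left_ideal b)"
    using assms card_ideal_mult_le[of a b] by (simp add: rank_def)
  then show ?thesis
    by (simp add: green_L_def card_subset_eq left_ideal_mult_subset)
qed

lemma rank_eq_if_green_L:
  assumes "(a, b) \<in> green_L"
  shows "rank a = rank b"
proof -
  have "rank c \<le> rank d" if "(c, d) \<in> green_L" for c d :: 'a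
    using that by (cases rule: green_L_cases) (auto simp: rank_mult_le)
  then show ?thesis
    using assms green_L_sym by (metis order_antisym)
qed

text \<open>Equal rank puts \<open>a * b\<close> in the R-class of \<open>a\<close> and the L-class
  of \<open>b\<close>, hence in the H-class of \<open>a\<close>. The finiteness direction uses
  H-triviality only through this dichotomy.\<close>

lemma mult_eq_left_or_rank_less:
  fixes a b :: "'a::{semigroup_mult, finite}"
  assumes trivial: "\<And>a b :: 'a. (a, b) \<in> green_H \<Longrightarrow> a = b" and L: "(a, b) \<in> green_L"
  shows "a * b = a \<or> rank (a * b) < rank a"
proof (cases "rank (a * b) = rank a")
  case True
  then have "(a * b, a) \<in> green_R" by (rule green_R_if_rank_eq)
  moreover have "(a * b, a) \<in> green_L"
    using True L by (metis green_L_if_rank_eq green_L_sym green_L_trans rank_eq_if_green_L)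
  ultimately show ?thesis
    using trivial by (simp add: green_H_def)
next
  case False
  then show ?thesis using rank_mult_le(1)[of a b] by simp
qed

section \<open>Words of states\<close>

definition act :: "'a::semigroup_mult list \<Rightarrow> 'a transformation" where
  "act = fold (state_action cayley_automaton)"

text \<open>In the Cayley automaton new state and output coincide. Hence the successor states of a
  word are its intermediate outputs, the last of which is the output of the cascade.\<close>

primrec out_letter :: "'a::semigroup_mult list \<Rightarrow> 'a \<Rightarrow> 'a" where
  "out_letter [] y = y"
| "out_letter (c # w) y = out_letter w (c * y)"

primrec next_word :: "'a::semigroup_mult list \<Rightarrow> 'a \<Rightarrow> 'a list" where
  "next_word [] y = []"
| "next_word (c # w) y = (c * y) # next_word w (c * y)"

text \<open>The section, or residual, of \<open>f\<close> at \<open>y\<close>; a relation, because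
  an arbitrary transformation need not have one.\<close>

definition derivative ::
    "'a transformation \<Rightarrow> 'a \<Rightarrow> 'a \<Rightarrow> 'a transformation \<Rightarrow> bool" where
  "derivative f y a g \<longleftrightarrow>
    (\<forall>x. x 0 = y \<longrightarrow> f x 0 = a \<and> (\<forall>n. f x (Suc n) = g (\<lambda>i. x (Suc i)) n))"

lemma act_append: "act (u @ v) = act v \<circ> act u"
  by (simp add: act_def)

lemma next_word_append: "next_word (u @ v) y = next_word u y @ next_word v (out_letter u y)"
  by (induction u arbitrary: y) auto

lemma cayley_action_shift:
  "state_action cayley_automaton c x (Suc n) =
    state_action cayley_automaton (c * x 0) (\<lambda>i. x (Suc i)) n"
  by (induction n) (simp_all add: cayley_action_0 cayley_action_Suc)

lemma derivative_act: "derivative (act w) y (out_letter w y) (act (next_word w y))"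
proof -
  have "act w x 0 = out_letter w (x 0) \<and>
      (\<forall>n. act w x (Suc n) = act (next_word w (x 0)) (\<lambda>i. x (Suc i)) n)" for x
  proof (induction w arbitrary: x)
    case (Cons c w)
    let ?x = "state_action cayley_automaton c x"
    have "(\<lambda>i. ?x (Suc i)) = state_action cayley_automaton (c * x 0) (\<lambda>i. x (Suc i))"
      using cayley_action_shift by blast
    then show ?case
      using Cons.IH[of ?x] by (simp add: act_def cayley_action_0)
  qed (simp add: act_def)
  then show ?thesis by (auto simp: derivative_def)
qed

lemma cayley_semigroup_eq: "cayley_semigroup = act ` {w. w \<noteq> []}"
proof (intro equalityI subsetI)
  fix f :: "'a transformation"
  assume "f \<in> cayley_semigroup"
  then have "f \<in> generated_semigroup (range (state_action cayley_automaton))"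
    by (simp add: cayley_semigroup_def)
  then show "f \<in> act ` {w. w \<noteq> []}"
  proof induction
    case (generator f)
    then obtain s where "f = state_action cayley_automaton s" by blast
    then have "f = act [s]" by (simp add: act_def)
    then show ?case by blast
  next
    case (product f g)
    then obtain u v where "f = act u" "g = act v" "u \<noteq> []" by blast
    then show ?case by (auto simp flip: act_append)
  qed
next
  have "act w \<in> cayley_semigroup" if "w \<noteq> []" for w :: "'a list"
    using that
  proof (induction w rule: rev_nonempty_induct)
    case (single s)
    then show ?case
      by (auto simp: act_def cayley_semigroup_def intro: generated_semigroup.generator)
  next
    case (snoc s w)
    have "act (w @ [s]) = state_action cayley_automaton s \<circ> act w"
      by (simp add: act_def fun_eq_iff)
    then show ?case
      using snoc.IH unfolding cayley_semigroup_def
      by (simp only:) (rule generated_semigroup.product[OF _ generated_semigroup.generator[OF rangeI]])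
  qed
  then show "f \<in> cayley_semigroup" if "f \<in> act ` {w. w \<noteq> []}" for f :: "'a transformation"
    using that by auto
qed

section \<open>Finiteness from derivatives\<close>

text \<open>A member of \<open>X\<close> is determined by its table of first letters, outputs and
  derivatives, and a finite \<open>Z\<close> allows finitely many tables.\<close>

lemma finite_if_finite_derivatives:
  fixes X :: "'a::finite transformation set"
  assumes "finite Z" and "\<And>f y. f \<in> X \<Longrightarrow> \<exists>a. \<exists>g\<in>Z. derivative f y a g"
  shows "finite X"
proof -
  define graph where "graph f = {(y, a, g). g \<in> Z \<and> derivative f y a g}" for f
  have "f = f'" if f: "f \<in> X" and eq: "graph f = graph f'" for f f'
  proof (intro ext)
    fix x :: "nat \<Rightarrow> 'a" and n
    obtain a g where "(x 0, a, g) \<in> graph f"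
      using assms(2)[OF f, of "x 0"] by (fastforce simp: graph_def)
    moreover from this have "(x 0, a, g) \<in> graph f'" using eq by simp
    ultimately show "f x n = f' x n"
      by (cases n) (auto simp: graph_def derivative_def)
  qed
  then have "inj_on graph X" by (intro inj_onI)
  moreover have "graph ` X \<subseteq> Pow (UNIV \<times> UNIV \<times> Z)"
    by (auto simp: graph_def)
  then have "finite (graph ` X)"
    by (rule finite_subset) (simp add: assms(1))
  ultimately show ?thesis by (rule finite_imageD[rotated])
qed

text \<open>There are only finitely many Mealy machines whose states are labelled by a fixed finite set.\<close>

lemma finite_if_uniformly_finite_state:
  fixes F :: "'v \<Rightarrow> 'k \<Rightarrow> 'a::finite transformation"
  assumes "finite K" and sub: "\<And>v. v \<in> V \<Longrightarrow> Q v \<subseteq> K"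
    and step: "\<And>v k y. v \<in> V \<Longrightarrow> k \<in> Q v \<Longrightarrow> \<exists>a. \<exists>k'\<in>Q v. derivative (F v k) y a (F v k')"
  shows "finite {F v k | v k. v \<in> V \<and> k \<in> Q v}"
proof -
  \<comment> \<open>State names come from the common set \<open>K\<close>, so tables for different
    \<open>v\<close> are comparable. Equal tables give equal actions, by induction on the
    position.\<close>
  define graph where
    "graph v = {(k, y, a, k'). k \<in> Q v \<and> k' \<in> Q v \<and> derivative (F v k) y a (F v k')}" for v
  have eq: "F v k x n = F v' k x n"
    if v: "v \<in> V" and graph: "graph v = graph v'" and "k \<in> Q v" for v v' k x n
    using \<open>k \<in> Q v\<close>
  proof (induction n arbitrary: k x)
    case 0
    obtain a k' where "(k, x 0, a, k') \<in> graph v"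
      using step[OF v 0, of "x 0"] 0 by (fastforce simp: graph_def)
    moreover from this have "(k, x 0, a, k') \<in> graph v'" using graph by simp
    ultimately show ?case by (auto simp: graph_def derivative_def)
  next
    case (Suc n)
    obtain a k' where *: "(k, x 0, a, k') \<in> graph v"
      using step[OF v Suc.prems, of "x 0"] Suc.prems by (fastforce simp: graph_def)
    moreover from this have "(k, x 0, a, k') \<in> graph v'" using graph by simp
    moreover have "F v k' (\<lambda>i. x (Suc i)) n = F v' k' (\<lambda>i. x (Suc i)) n"
      using * by (intro Suc.IH) (simp add: graph_def)
    ultimately show ?case by (simp add: graph_def derivative_def)
  qed
  define G where "G = (\<lambda>(g, k). F (SOME v. v \<in> V \<and> graph v = g) k)"
  have "graph ` V \<subseteq> Pow (K \<times> UNIV \<times> UNIV \<times> K)"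
    using sub by (fastforce simp: graph_def)
  then have "finite (graph ` V)"
    by (rule finite_subset) (simp add: assms(1))
  then have "finite (G ` (graph ` V \<times> K))"
    using assms(1) by simp
  moreover have "F v k \<in> G ` (graph ` V \<times> K)" if "v \<in> V" "k \<in> Q v" for v k
  proof -
    define v' where "v' = (SOME v'. v' \<in> V \<and> graph v' = graph v)"
    have "v' \<in> V \<and> graph v' = graph v"
      unfolding v'_def by (rule someI[of _ v]) (simp add: that)
    then have "F v k = F v' k"
      by (intro ext eq) (simp_all add: that)
    also have "\<dots> = G (graph v, k)" by (simp add: G_def v'_def)
    finally have "F v k = G (graph v, k)" .
    then show ?thesis using that sub by blast
  qed
  ultimately show ?thesis
    by (auto elim: finite_subset[rotated])
qed

section \<open>Words over an \<open>\<L>\<close>-class\<close>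

definition L_word :: "'a::semigroup_mult list \<Rightarrow> bool" where
  "L_word v \<longleftrightarrow> (\<forall>a\<in>set v. \<forall>b\<in>set v. (a, b) \<in> green_L)"

abbreviation words_of_rank_le :: "nat \<Rightarrow> 'a::{semigroup_mult, finite} list set" where
  "words_of_rank_le m \<equiv> lists {a. rank a \<le> m}"

abbreviation words_of_rank_less :: "nat \<Rightarrow> 'a::{semigroup_mult, finite} list set" where
  "words_of_rank_less m \<equiv> lists {a. rank a < m}"

lemma next_word_rank_le: "w \<in> words_of_rank_le m \<Longrightarrow> next_word w y \<in> words_of_rank_le m"
  by (induction w arbitrary: y) (auto intro: order_trans[OF rank_mult_le(1)])

lemma next_word_rank_less: "rank y < m \<Longrightarrow> next_word w y \<in> words_of_rank_less m"
  by (induction w arbitrary: y) (auto intro: le_less_trans[OF rank_mult_le(2)])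

text \<open>The letters are successive left multiples of \<open>y\<close>. They stay in its L-class
  until the rank first drops, and the rank never recovers.\<close>

lemma next_word_decomp:
  "\<exists>v u. next_word w y = v @ u \<and> (\<forall>a\<in>set v. (a, y) \<in> green_L) \<and> u \<in> words_of_rank_less (rank y)"
proof (induction w arbitrary: y)
  case (Cons c w)
  show ?case
  proof (cases "rank (c * y) = rank y")
    case True
    then have L: "(c * y, y) \<in> green_L" by (rule green_L_if_rank_eq)
    obtain v u where "next_word w (c * y) = v @ u" "\<forall>a\<in>set v. (a, c * y) \<in> green_L"
      "u \<in> words_of_rank_less (rank y)"
      using Cons.IH[of "c * y"] True by metis
    then show ?thesis
      using L by (intro exI[of _ "(c * y) # v"] exI[of _ u]) (auto intro: green_L_trans)
  next
    case False
    then have "rank (c * y) < rank y" using rank_mult_le(2)[of c y] by simp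
    then show ?thesis
      using next_word_rank_less[of "c * y" "rank y" w]
      by (intro exI[of _ "[]"] exI[of _ "next_word (c # w) y"]) simp
  qed
qed simp

text \<open>The first letter in \<open>T\<close> is kept, because a letter that causes a fall
  affects only what comes after it.\<close>

primrec upto_first :: "'a set \<Rightarrow> 'a list \<Rightarrow> 'a list" where
  "upto_first T [] = []"
| "upto_first T (a # w) = a # (if a \<in> T then [] else upto_first T w)"

lemma upto_first_empty: "upto_first {} w = w"
  by (induction w) auto

lemma set_upto_first: "set (upto_first T w) \<subseteq> set w"
  by (induction w) auto

text \<open>Truncated relabellings are closed under composition. Over a finite alphabet there are
  finitely many of them, whatever the length of the word.\<close>

lemma upto_first_map_upto_first:
  "upto_first T (map g (upto_first U w)) = map g (upto_first (U \<union> g -` T) w)"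
  by (induction w) auto

text \<open>If \<open>c * a = c\<close>, then \<open>c * (a * y)\<close> collapses to
  \<open>c * y\<close>; otherwise the rank drops for good. The fixed representative \<open>b\<close>
  keeps the stopping set constant along the induction.\<close>

lemma next_L_word_aux:
  fixes a :: "'a::{semigroup_mult, finite}"
  assumes trivial: "\<And>a b :: 'a. (a, b) \<in> green_H \<Longrightarrow> a = b"
    and "rank (a * y) = rank a" "(a, b) \<in> green_L" "\<forall>c\<in>set v. (c, b) \<in> green_L"
  shows "\<exists>u \<in> words_of_rank_less (rank b).
    (a * y) # next_word v (a * y) = map (\<lambda>c. c * y) (upto_first {t. b * t \<noteq> b} (a # v)) @ u"
  using assms(2-)
proof (induction v arbitrary: a)
  case (Cons c v)
  have cb: "(c, b) \<in> green_L" using Cons.prems by simp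
  have ca: "(c, a) \<in> green_L"
    using cb Cons.prems(2) by (metis green_L_sym green_L_trans)
  \<comment> \<open>Distinct members of an L-class are left multiples of each other, so right
    multiplication by \<open>a\<close> fixes all of them or none.\<close>
  have fix_iff: "c * a = c \<longleftrightarrow> b * a = b"
  proof -
    have "p * a = p" if "(p, q) \<in> green_L" "q * a = q" for p q
      using that(1) by (cases rule: green_L_cases) (auto simp: that(2) mult.assoc)
    then show ?thesis using cb green_L_sym by metis
  qed
  show ?case
  proof (cases "b * a = b")
    case True
    then have eq: "c * (a * y) = c * y" using fix_iff by (simp flip: mult.assoc)
    have "rank (c * y) = rank c"
      using rank_eq_if_green_L[OF green_L_mult[OF ca, of y]] rank_eq_if_green_L[OF ca]
        Cons.prems(1) by simp
    then obtain u where "u \<in> words_of_rank_less (rank b)"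
      "(c * y) # next_word v (c * y) =
        map (\<lambda>c. c * y) (upto_first {t. b * t \<noteq> b} (c # v)) @ u"
      using Cons.IH[of c] Cons.prems cb by auto
    then show ?thesis using True eq by auto
  next
    case False
    then have "rank (c * a) < rank b"
      using mult_eq_left_or_rank_less[OF trivial ca] fix_iff rank_eq_if_green_L[OF cb] by auto
    then have less: "rank (c * (a * y)) < rank b"
      using rank_mult_le(1)[of "c * a" y] by (simp add: mult.assoc)
    then have "next_word (c # v) (a * y) \<in> words_of_rank_less (rank b)"
      using next_word_rank_less[OF less] by simp
    then show ?thesis using False by auto
  qed
qed simp

lemma next_L_word:
  fixes v :: "'a::{semigroup_mult, finite} list"
  assumes trivial: "\<And>a b :: 'a. (a, b) \<in> green_H \<Longrightarrow> a = b"
    and v: "L_word v" "v \<in> words_of_rank_le (Suc m)"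
  shows "\<exists>u \<in> words_of_rank_le m. next_word v y = u \<or>
    (\<exists>T. next_word v y = map (\<lambda>c. c * y) (upto_first T v) @ u)"
proof (cases v)
  case Nil
  then show ?thesis by (intro bexI[of _ "[]"]) auto
next
  case (Cons a v')
  have less: "u \<in> words_of_rank_le m" if "u \<in> words_of_rank_less (rank a)" for u :: "'a list"
    using that v(2) Cons by fastforce
  show ?thesis
  proof (cases "rank (a * y) = rank a")
    case True
    have L: "(a, a) \<in> green_L" "\<forall>c\<in>set v'. (c, a) \<in> green_L"
      using v(1) Cons by (auto simp: L_word_def)
    have "next_word v y = (a * y) # next_word v' (a * y)"
      using Cons by simp
    then show ?thesis
      using next_L_word_aux[OF trivial True L] Cons less by metis
  next
    case False
    then have "rank (a * y) < rank a" using rank_mult_le(1)[of a y] by simp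
    then have "next_word v y \<in> words_of_rank_less (rank a)"
      using next_word_rank_less[of "a * y" "rank a" v'] Cons by simp
    then show ?thesis using less by blast
  qed
qed

section \<open>Finiteness\<close>

text \<open>A state of the machine for \<open>v\<close> is named by the action of a tail of lower
  rank and by a map that derives the current L-word from \<open>v\<close>. Recording only the action
  of the tail leaves finitely many names, independently of \<open>v\<close>.\<close>

lemma finite_act_L_words:
  assumes trivial: "\<And>a b :: 'a::{semigroup_mult, finite}. (a, b) \<in> green_H \<Longrightarrow> a = b"
    and fin: "finite (act ` (words_of_rank_le m :: 'a list set))"
  shows "finite (act ` {v \<in> words_of_rank_le (Suc m) :: 'a list set. L_word v})"
proof -
  define V where "V = {v \<in> words_of_rank_le (Suc m) :: 'a list set. L_word v}"
  define prefix :: "'a set \<times> ('a \<Rightarrow> 'a) \<Rightarrow> 'a list \<Rightarrow> 'a list"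
    where "prefix = (\<lambda>(T, g) v. map g (upto_first T v))"
  \<comment> \<open>The constant empty word serves the case in which every letter falls.\<close>
  define \<Phi> where "\<Phi> = insert (\<lambda>_. []) (range prefix)"
  define Q where "Q v = act ` (words_of_rank_le m :: 'a list set) \<times> {\<phi> \<in> \<Phi>. \<phi> v \<in> V}" for v
  define F :: "'a list \<Rightarrow> 'a transformation \<times> ('a list \<Rightarrow> 'a list) \<Rightarrow> 'a transformation"
    where "F v = (\<lambda>(f, \<phi>). f \<circ> act (\<phi> v))" for v
  have Nil_V: "[] \<in> V" by (simp add: V_def L_word_def)
  have step: "\<exists>a. \<exists>k'\<in>Q v. derivative (F v k) y a (F v k')" if kQ: "k \<in> Q v" for v k y
  proof -
    obtain w \<phi> where w: "w \<in> words_of_rank_le m" and \<phi>: "\<phi> \<in> \<Phi>" "\<phi> v \<in> V" and k: "k = (act w, \<phi>)"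
      using kQ by (auto simp: Q_def)
    have "F v k = act (\<phi> v @ w)" by (simp add: F_def k act_append)
    then have der: "derivative (F v k) y (out_letter (\<phi> v @ w) y)
        (act (next_word (\<phi> v) y @ next_word w (out_letter (\<phi> v) y)))"
      using derivative_act[of "\<phi> v @ w" y] by (simp add: next_word_append)
    have next_w: "next_word w (out_letter (\<phi> v) y) \<in> words_of_rank_le m" (is "?w \<in> _")
      using w by (rule next_word_rank_le)
    \<comment> \<open>The newly fallen letters \<open>u\<close> join the successor of the old
      tail.\<close>
    have *: "\<exists>k'\<in>Q v. act (next_word (\<phi> v) y @ ?w) = F v k'"
      if "u \<in> words_of_rank_le m" "next_word (\<phi> v) y = \<psi> v @ u" "\<psi> \<in> \<Phi>" "\<psi> v \<in> V" for u \<psi>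
      using that next_w
      by (intro bexI[of _ "(act (u @ ?w), \<psi>)"]) (auto simp: F_def Q_def simp flip: act_append)
    have "L_word (\<phi> v)" and "\<phi> v \<in> words_of_rank_le (Suc m)"
      using \<phi>(2) by (auto simp: V_def)
    then obtain u where u: "u \<in> words_of_rank_le m" and "next_word (\<phi> v) y = u \<or>
        (\<exists>T. next_word (\<phi> v) y = map (\<lambda>c. c * y) (upto_first T (\<phi> v)) @ u)"
      using next_L_word[OF trivial, of "\<phi> v" m y] by blast
    then consider (fall) "next_word (\<phi> v) y = u"
      | (prefix) T where "next_word (\<phi> v) y = map (\<lambda>c. c * y) (upto_first T (\<phi> v)) @ u"
      by blast
    then have "\<exists>k'\<in>Q v. act (next_word (\<phi> v) y @ ?w) = F v k'"
    proof cases
      case fall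
      then show ?thesis using *[of u "\<lambda>_. []"] u Nil_V by (simp add: \<Phi>_def)
    next
      case (prefix T)
      show ?thesis
      proof (cases "\<phi> = (\<lambda>_. [])")
        case True
        then show ?thesis using *[of "[]" "\<lambda>_. []"] Nil_V by (simp add: \<Phi>_def)
      next
        case False
        then obtain U g where "\<phi> = prefix (U, g)" using \<phi>(1) by (auto simp: \<Phi>_def)
        then have eq: "map (\<lambda>c. c * y) (upto_first T (\<phi> v)) =
            prefix (U \<union> g -` T, (\<lambda>c. c * y) \<circ> g) v"
          by (simp add: prefix_def upto_first_map_upto_first)
        have "map (\<lambda>c. c * y) (upto_first T (\<phi> v)) \<in> V"
          using \<phi>(2) set_upto_first[of T "\<phi> v"]
          by (fastforce simp: V_def L_word_def intro: green_L_mult order_trans[OF rank_mult_le(1)])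
        then show ?thesis
          using *[of u "prefix (U \<union> g -` T, (\<lambda>c. c * y) \<circ> g)"] u prefix eq by (simp add: \<Phi>_def)
      qed
    qed
    then show ?thesis using der by metis
  qed
  have "finite (act ` (words_of_rank_le m :: 'a list set) \<times> \<Phi>)"
    using fin by (simp add: \<Phi>_def)
  then have "finite {F v k | v k. v \<in> V \<and> k \<in> Q v}"
    by (rule finite_if_uniformly_finite_state[OF _ _ step]) (auto simp: Q_def)
  moreover have "act v \<in> {F v k | v k. v \<in> V \<and> k \<in> Q v}" if "v \<in> V" for v
  proof -
    \<comment> \<open>The initial state: nothing cut off, identity relabelling, empty tail.\<close>
    have "prefix ({}, id) v = v" by (simp add: prefix_def upto_first_empty)
    then have "(act [], prefix ({}, id)) \<in> Q v" "act v = F v (act [], prefix ({}, id))"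
      using that by (auto simp: Q_def F_def \<Phi>_def simp flip: act_append)
    then show ?thesis using that by blast
  qed
  ultimately show ?thesis
    by (auto simp flip: V_def elim: finite_subset[rotated])
qed

text \<open>Reading one letter turns a word into an L-word followed by letters of smaller rank. So
  every derivative is composed from two finite sets, the second finite by induction.\<close>

lemma finite_act_words_of_rank_le:
  assumes trivial: "\<And>a b :: 'a::{semigroup_mult, finite}. (a, b) \<in> green_H \<Longrightarrow> a = b"
  shows "finite (act ` (words_of_rank_le m :: 'a list set))"
proof (induction m)
  case 0
  have "rank a \<noteq> 0" for a :: 'a
    by (simp add: rank_def left_ideal_def)
  then have "{a :: 'a. rank a \<le> 0} = {}" by simp
  then show ?case by (simp only: lists_empty) simp
next
  case (Suc m)
  define V where "V = {v \<in> words_of_rank_le (Suc m) :: 'a list set. L_word v}"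
  define Z where "Z = (\<lambda>(f, g). g \<circ> f) ` (act ` V \<times> act ` words_of_rank_le m)"
  have "finite Z"
    using finite_act_L_words[OF trivial Suc] Suc by (simp add: Z_def V_def)
  then show ?case
  proof (rule finite_if_finite_derivatives)
    fix f :: "'a transformation" and y
    assume "f \<in> act ` words_of_rank_le (Suc m)"
    then obtain w where w: "w \<in> words_of_rank_le (Suc m)" and f: "f = act w" by blast
    have "\<exists>v\<in>V. \<exists>u\<in>words_of_rank_le m. next_word w y = v @ u"
    proof (cases w)
      case Nil
      then show ?thesis by (auto simp: V_def L_word_def)
    next
      case (Cons c w')
      obtain v u where *: "next_word w' (c * y) = v @ u" "\<forall>a\<in>set v. (a, c * y) \<in> green_L"
        "u \<in> words_of_rank_less (rank (c * y))"
        using next_word_decomp by blast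
      have "rank (c * y) \<le> Suc m"
        using w Cons rank_mult_le(1)[of c y] by simp
      moreover have "L_word ((c * y) # v)"
        unfolding L_word_def using *(2) by (auto simp: green_L_def)
      moreover have "rank a = rank (c * y)" if "a \<in> set v" for a
        using that *(2) rank_eq_if_green_L by blast
      ultimately have V: "(c * y) # v \<in> V" and u: "u \<in> words_of_rank_le m"
        using *(3) by (auto simp: V_def)
      have "next_word w y = ((c * y) # v) @ u" using *(1) Cons by simp
      then show ?thesis using V u by blast
    qed
    then obtain v u where "v \<in> V" "u \<in> words_of_rank_le m" "next_word w y = v @ u"
      by blast
    then have "act (next_word w y) \<in> Z"
      unfolding Z_def by (intro image_eqI[of _ _ "(act v, act u)"]) (auto simp: act_append)
    then show "\<exists>a. \<exists>g\<in>Z. derivative f y a g"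
      using derivative_act f by blast
  qed
qed

lemma finite_cayley_semigroup:
  assumes trivial: "\<And>a b :: 'a::{semigroup_mult, finite}. (a, b) \<in> green_H \<Longrightarrow> a = b"
  shows "finite (cayley_semigroup :: 'a transformation set)"
proof -
  have "rank a \<le> card (UNIV :: 'a set) + card (UNIV :: 'a set)" for a :: 'a
    unfolding rank_def by (intro add_mono card_mono) auto
  then have "(cayley_semigroup :: 'a transformation set) \<subseteq>
      act ` words_of_rank_le (card (UNIV :: 'a set) + card (UNIV :: 'a set))"
    by (auto simp: cayley_semigroup_eq)
  then show ?thesis
    using finite_act_words_of_rank_le[OF trivial] by (rule finite_subset)
qed

section \<open>Infiniteness\<close>

text \<open>Shifted by one, because there is no zeroth power in a semigroup.\<close>

primrec power_Suc :: "'a::semigroup_mult \<Rightarrow> nat \<Rightarrow> 'a" where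
  "power_Suc s 0 = s"
| "power_Suc s (Suc n) = s * power_Suc s n"

lemma power_Suc_mult: "power_Suc s m * power_Suc s n = power_Suc s (Suc (m + n))"
  by (induction m) (simp_all add: mult.assoc)

text \<open>Write \<open>b = s * a = a * v\<close> and \<open>a = b * u\<close>. On the elements
  \<open>power_Suc s n * a\<close>, left multiplication by \<open>s\<close> becomes right
  multiplication by \<open>v\<close>, which \<open>u\<close> undoes. An equality of consecutive ones
  thus descends to \<open>a = b\<close>.\<close>

lemma power_Suc_distinct_if_not_H_trivial:
  fixes a b :: "'a::semigroup_mult"
  assumes "(a, b) \<in> green_H" "a \<noteq> b"
  obtains s :: 'a where "\<And>n. power_Suc s (Suc n) \<noteq> power_Suc s n"
proof -
  have L: "(b, a) \<in> green_L" and R: "(a, b) \<in> green_R" "(b, a) \<in> green_R"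
    using assms(1) by (auto simp: green_H_def green_L_def green_R_def)
  obtain s where s: "b = s * a"
    using L assms(2) by (cases rule: green_L_cases) auto
  obtain u where u: "a = b * u"
    using R(1) assms(2) by (cases rule: green_R_cases) auto
  obtain v where v: "b = a * v"
    using R(2) assms(2) by (cases rule: green_R_cases) auto
  have sa: "s * a = a * v" and avu: "a * v * u = a"
    using s[symmetric] u[symmetric] v[symmetric] by simp_all
  have shift: "power_Suc s n * a * v = power_Suc s (Suc n) * a" for n
  proof (induction n)
    case 0
    then show ?case by (metis mult.assoc power_Suc.simps sa)
  next
    case (Suc n)
    then show ?case by (metis mult.assoc power_Suc.simps(2))
  qed
  have "power_Suc s (Suc n) * a \<noteq> power_Suc s n * a" for n
  proof (induction n)
    case 0
    show ?case
    proof
      assume "power_Suc s (Suc 0) * a = power_Suc s 0 * a"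
      then have "s * s * a * u = s * a * u" by simp
      also have "s * s * a * u = b" using sa avu s by (metis mult.assoc)
      also have "s * a * u = a" using s u by simp
      finally show False using assms(2) by simp
    qed
  next
    case (Suc n)
    have "power_Suc s (Suc m) * a * u = power_Suc s m * a" for m
      using shift[of m] avu by (metis mult.assoc)
    then show ?case using Suc by metis
  qed
  then show ?thesis using that by metis
qed

text \<open>The powers of \<open>s\<close> are eventually periodic, and the periodic ones form a
  cyclic group, which \<open>\<gamma>\<close> parametrizes by exponents. It is nontrivial since
  consecutive powers differ.\<close>

lemma int_hom_if_power_Suc_distinct:
  fixes s :: "'a::{semigroup_mult, finite}"
  assumes "\<And>n. power_Suc s (Suc n) \<noteq> power_Suc s n"
  obtains \<gamma> :: "int \<Rightarrow> 'a" where "\<And>a b. \<gamma> (a + b) = \<gamma> a * \<gamma> b" "\<gamma> 1 \<noteq> \<gamma> 0"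
proof -
  have "\<not> inj (power_Suc s)"
    using finite_imageD[of "power_Suc s" UNIV] by auto
  then obtain i j where "i < j" "power_Suc s i = power_Suc s j"
    unfolding inj_def by (metis linorder_neqE_nat)
  then obtain p where p: "p > 0" "power_Suc s (i + p) = power_Suc s i"
    by (metis less_imp_add_positive)
  have period: "power_Suc s (n + p) = power_Suc s n" if "i \<le> n" for n
    using that by (induction n rule: dec_induct) (simp_all add: p)
  have period': "power_Suc s (n + t * p) = power_Suc s n" if "i \<le> n" for n t
  proof (induction t)
    case (Suc t)
    then show ?case
      using period[of "n + t * p"] that by (simp add: ac_simps)
  qed simp
  have eqI: "power_Suc s m = power_Suc s n" if "i \<le> m" "i \<le> n" "int m mod int p = int n mod int p" for m n
  proof -
    have "power_Suc s m = power_Suc s n" if le: "i \<le> m" "m \<le> n" and "int m mod int p = int n mod int p" for m n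
    proof -
      have "m mod p = n mod p" using that(3) by (metis of_nat_eq_iff zmod_int)
      then obtain t where "n = m + t * p"
        using le(2) by (metis mod_eq_dvd_iff_nat dvd_def le_add_diff_inverse mult.commute)
      then show ?thesis using period' le(1) by simp
    qed
    then show ?thesis using that by (metis nat_le_linear)
  qed
  \<comment> \<open>\<open>power_Suc s N\<close> has true exponent \<open>N + 1\<close>, a multiple
    of the period, so it is the identity of the group. The factor \<open>Suc i\<close> moves it past
    the preperiod.\<close>
  define N where "N = Suc i * p - 1"
  have N: "i \<le> N" "int N = int (Suc i) * int p - 1"
    using p(1) by (cases p; simp add: N_def algebra_simps)+
  define \<gamma> where "\<gamma> z = power_Suc s (N + nat (z mod int p))" for z
  show ?thesis
  proof
    show "\<gamma> (a + b) = \<gamma> a * \<gamma> b" for a b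
      unfolding \<gamma>_def power_Suc_mult
    proof (rule eqI)
      have "int (Suc (N + nat (a mod int p) + (N + nat (b mod int p)))) =
          int N + (a mod int p + b mod int p) + int (Suc i) * int p"
        using p(1) N(2) by simp
      also have "\<dots> mod int p = (int N + (a + b)) mod int p"
        unfolding mod_mult_self1 by (metis mod_add_eq mod_add_right_eq)
      also have "\<dots> = int (N + nat ((a + b) mod int p)) mod int p"
        using p(1) by (simp add: mod_simps)
      finally show "int (N + nat ((a + b) mod int p)) mod int p =
          int (Suc (N + nat (a mod int p) + (N + nat (b mod int p)))) mod int p" ..
    qed (use N in auto)
    have "\<gamma> 1 = power_Suc s (Suc N)"
      unfolding \<gamma>_def
    proof (rule eqI)
      show "int (N + nat (1 mod int p)) mod int p = int (Suc N) mod int p"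
        using p(1) by (simp add: mod_simps ac_simps)
    qed (use N in auto)
    then show "\<gamma> 1 \<noteq> \<gamma> 0" using assms[of N] by (simp add: \<gamma>_def)
  qed
qed

text \<open>On exponents, the partial products formed by the state \<open>\<gamma> 0\<close> become
  partial sums of integers.\<close>

lemma infinite_cayley_semigroup:
  fixes \<gamma> :: "int \<Rightarrow> 'a::semigroup_mult"
  assumes hom: "\<And>a b. \<gamma> (a + b) = \<gamma> a * \<gamma> b" and ne: "\<gamma> 1 \<noteq> \<gamma> 0"
  shows "infinite (cayley_semigroup :: 'a transformation set)"
proof -
  define f where "f = state_action cayley_automaton (\<gamma> 0)"
  text \<open>The exponents are the coefficients of \<open>(1 - t)\<^sup>j\<close>.\<close>
  define z where "z j n = \<gamma> ((-1) ^ n * int (j choose n))" for j n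
  have "f (z (Suc j)) n = z j n" for j n
  proof (induction n)
    case 0
    then show ?case by (simp add: f_def z_def cayley_action_0 flip: hom)
  next
    case (Suc n)
    then have "f (z (Suc j)) (Suc n) = z j n * z (Suc j) (Suc n)"
      by (simp add: f_def cayley_action_Suc)
    \<comment> \<open>Pascal's rule, with alternating signs.\<close>
    also have "\<dots> = z j (Suc n)"
      by (simp add: z_def algebra_simps flip: hom)
    finally show ?case .
  qed
  then have f_z: "f (z (Suc j)) = z j" for j by blast
  have pow_z: "(f ^^ k) (z (k + j)) = z j" for k j
    by (induction k) (simp_all add: funpow_swap1 f_z)
  \<comment> \<open>At position \<open>d\<close> the exponents are 1 or -1 on one side and 0 on the
    other.\<close>
  have z_ne: "z d \<noteq> z 0" if "d > 0" for d
  proof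
    assume "z d = z 0"
    then have "z d d = z 0 d" by simp
    then have "\<gamma> ((-1) ^ d) = \<gamma> 0"
      using that by (simp add: z_def binomial_eq_0)
    then have "\<gamma> (- 1) = \<gamma> 0"
      using ne by (cases "even d") auto
    then show False
      using ne hom[of "- 1" 1] hom[of 0 1] by simp
  qed
  \<comment> \<open>The sequence \<open>z (Suc l)\<close> separates the two powers. Exponents start
    at 1 because the identity map need not lie in the semigroup.\<close>
  have "f ^^ Suc k \<noteq> f ^^ Suc l" if "k < l" for k l
  proof
    assume eq: "f ^^ Suc k = f ^^ Suc l"
    have "z (l - k) = (f ^^ Suc k) (z (Suc l))"
      using pow_z[of "Suc k" "l - k"] that by simp
    also have "\<dots> = z 0"
      unfolding eq using pow_z[of "Suc l" 0] by simp
    finally show False using z_ne that by simp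
  qed
  then have "inj (\<lambda>k. f ^^ Suc k)"
    by (intro injI) (metis linorder_neqE_nat)
  then have "infinite (range (\<lambda>k. f ^^ Suc k))"
    using finite_imageD infinite_UNIV_nat by blast
  moreover have "f ^^ Suc k \<in> cayley_semigroup" for k
  proof (induction k)
    case 0
    then show ?case
      by (auto simp: f_def cayley_semigroup_def intro: generated_semigroup.generator)
  next
    case (Suc k)
    then show ?case
      unfolding funpow.simps(2)[of "Suc k"] cayley_semigroup_def f_def
      by (blast intro: generated_semigroup.generator generated_semigroup.product)
  qed
  ultimately show ?thesis
    by (meson finite_subset image_subsetI)
qed

theorem theorem1p3:
  "finite (cayley_semigroup :: 'a::{semigroup_mult, finite} transformation set) \<longleftrightarrow>
    (\<forall>K \<in> UNIV // (green_H :: 'a rel). is_singleton K)"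
  unfolding singleton_green_H_classes_iff
proof
  assume "finite (cayley_semigroup :: 'a transformation set)"
  then show "\<forall>a b :: 'a. (a, b) \<in> green_H \<longrightarrow> a = b"
    by (metis power_Suc_distinct_if_not_H_trivial int_hom_if_power_Suc_distinct
        infinite_cayley_semigroup)
next
  assume "\<forall>a b :: 'a. (a, b) \<in> green_H \<longrightarrow> a = b"
  then show "finite (cayley_semigroup :: 'a transformation set)"
    by (intro finite_cayley_semigroup) simp
qed

end
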